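(* Let $(X,d)$ be a metric space and let $\mu$ be a nonnegative measure that is defined on a $\sigma$-algebra $\mathfrak{M}$ of subsets of $X$ which contains all Borel sets in $X$, and suppose that every ball in $X$ has finite $\mu$-measure. Then the following statements are equivalent. (a) The measure $\mu$ is Borel regular, i.e., for every measurable set $E\subseteq X$ there exists a Borel set $B\subseteq X$ such that $E\subseteq B$ and $\mu(B)=\mu(E)$. (b) Each measurable function has a Borel representative, i.e., for every measurable function $u:X\to\overline{\mathbb{R}}$ there exist a Borel set $N\subseteq X$ and a Borel function $f:X\to\overline{\mathbb{R}}$ such that $\mu(N)=0$ and $f=u$ pointwise in $X\setminus N$. (c) The weak Lusin theorem holds, i.e., for every measurable function $u:X\to\overline{\mathbb{R}}$ and any $\varepsilon\in(0,\infty)$ there exists a closed set $C_{\varepsilon}\subseteq X$ such that $\mu(X\setminus C_{\varepsilon})<\varepsilon$ and the restriction of $u$ to $C_{\varepsilon}$ is continuous. (d) The strong Lusin theorem holds, i.e., for every measurable function $u:X\to\overline{\mathbb{R}}$ and any $\varepsilon\in(0,\infty)$ there exist a closed set $C_{\varepsilon}\subseteq X$ and a continuous function $g:X\to\overline{\mathbb{R}}$ such that $\mu(X\setminus C_{\varepsilon})<\varepsilon$ and $g=u$ pointwise in $C_{\varepsilon}$.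
   Context: $\overline{\mathbb{R}}:=[-\infty,\infty]$ with its usual topology. The $\sigma$-algebra $\mathfrak{M}$ is only required to contain the Borel $\sigma$-algebra (it need not equal it). "Measurable set" means an element of $\mathfrak{M}$, and "measurable function" means measurable with respect to $\mathfrak{M}$; "Borel set" and "Borel function" refer to the Borel $\sigma$-algebra of the metric topology of $(X,d)$. *)

theory Defs
  imports "HOL-Analysis.Analysis"
begin

text \<open>
  The metric space \<open>X\<close> is the whole type \<open>'a\<close>, so the complement \<open>- S\<close> stands for the
  set difference of \<open>X\<close> and \<open>S\<close>. The sigma-algebra is \<open>sets M\<close>; it may be strictly larger
  than \<open>sets borel\<close>. Borel functions are measurable from \<open>borel\<close>, measurable functions are
  measurable from \<open>M\<close>; both take values in \<open>ereal\<close> with its Borel sets.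
\<close>

definition borel_regular :: "'a::metric_space measure \<Rightarrow> bool" where
  "borel_regular M \<longleftrightarrow>
     (\<forall>E\<in>sets M. \<exists>B\<in>sets borel. E \<subseteq> B \<and> emeasure M B = emeasure M E)"

definition borel_representatives :: "'a::metric_space measure \<Rightarrow> bool" where
  "borel_representatives M \<longleftrightarrow>
     (\<forall>u\<in>measurable M (borel :: ereal measure).
        \<exists>N\<in>sets borel. \<exists>f\<in>measurable borel (borel :: ereal measure).
          emeasure M N = 0 \<and> (\<forall>x\<in>- N. f x = u x))"

definition weak_lusin :: "'a::metric_space measure \<Rightarrow> bool" where
  "weak_lusin M \<longleftrightarrow>
     (\<forall>u\<in>measurable M (borel :: ereal measure). \<forall>\<epsilon>::real. \<epsilon> > 0 \<longrightarrow>
        (\<exists>C. closed C \<and> emeasure M (- C) < ennreal \<epsilon> \<and> continuous_on C u))"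

definition strong_lusin :: "'a::metric_space measure \<Rightarrow> bool" where
  "strong_lusin M \<longleftrightarrow>
     (\<forall>u\<in>measurable M (borel :: ereal measure). \<forall>\<epsilon>::real. \<epsilon> > 0 \<longrightarrow>
        (\<exists>C g. closed C \<and> continuous_on UNIV g \<and>
           emeasure M (- C) < ennreal \<epsilon> \<and> (\<forall>x\<in>C. g x = u x)))"

end

theory Submission
  imports Defs
begin

text \<open>
  The conditions are linked by the cycle: Borel regularity, weak Lusin, strong Lusin, weak Lusin,
  Borel representatives, Borel regularity.

  The metric enters through a sandwich property: for a finite measure, every Borel set lies
  between a closed set and an open set whose difference is small. The sets with this property
  form a sigma-algebra, and a closed set has it because it is the intersection of its shrinking
  open neighbourhoods. Applying the sandwich property inside each member of a countable family of
  balls that exhausts the space, and replacing a measurable set by a Borel hull in each ball, one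
  finds that Borel regularity makes every measurable set \<open>E\<close> outer regular in a strong sense: it
  has open supersets \<open>U\<close> with \<open>U - E\<close> of arbitrarily small measure, even when \<open>E\<close> itself has
  infinite measure.

  For the weak Lusin property, consider the preimages of open sets directly. For each set \<open>V\<close> of
  a countable base of the extended reals, the preimage of \<open>V\<close> is covered by an open set with a
  small error. Off the union of all the errors, each such preimage is relatively open, so the
  function is continuous there; a small open set containing all the errors is what has to be
  removed. The strong Lusin property then follows from the Tietze theorem, because the extended
  real line is homeomorphic to a compact interval.

  Conversely, closed sets on which a measurable function is continuous and whose complements have
  measure tending to zero exhaust the space up to a Borel null set, off which the function is
  Borel. Finally, a Borel representative of the indicator of a set yields a Borel hull of the set.
\<close>

section \<open>Closed and open approximation of Borel sets\<close>

lemma emeasure_UN_le_geometric: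
  assumes "\<And>n. A n \<in> sets M" and "0 \<le> e"
    and "\<And>n. emeasure M (A n) \<le> ennreal (e * (1/2) ^ Suc n)"
  shows "emeasure M (\<Union>n. A n) \<le> ennreal e"
proof -
  have "emeasure M (\<Union>n. A n) \<le> (\<Sum>n. emeasure M (A n))"
    using assms(1) by (intro emeasure_subadditive_countably) auto
  also have "\<dots> \<le> (\<Sum>n. ennreal (e * (1/2) ^ Suc n))"
    using assms(3) by (intro suminf_le summableI) auto
  also have "\<dots> = ennreal e"
    using sums_mult[OF power_half_series, of e] assms(2) by (intro suminf_ennreal_eq) auto
  finally show ?thesis .
qed

text \<open>
  The sandwiched sets form a sigma-algebra because the condition is symmetric under complements,
  and because, in a countable union, the closed inner sets can be cut down to a finite union:
  this is the place where continuity from above, hence finiteness of the measure, is needed.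
\<close>

lemma borel_closed_open_sandwich:
  fixes N :: "'a::metric_space measure"
  assumes borel_sub: "sets borel \<subseteq> sets N"
    and fin: "emeasure N UNIV < \<infinity>"
    and A: "A \<in> sets borel" and e: "0 < (e::real)"
  shows "\<exists>F U. closed F \<and> open U \<and> F \<subseteq> A \<and> A \<subseteq> U \<and> emeasure N (U - F) < ennreal e"
proof -
  have op [simp]: "S \<in> sets N" if "open S" for S
    using that borel_sub by (auto intro: borel_open)
  have cl [simp]: "S \<in> sets N" if "closed S" for S
    using that borel_sub by (auto intro: borel_closed)
  have fin': "emeasure N S \<noteq> \<infinity>" for S
  proof -
    have "emeasure N S \<le> emeasure N UNIV" by (rule emeasure_mono) auto
    with fin show ?thesis by (auto simp: top_unique)
  qed
  have "A \<in> sigma_sets UNIV (Collect closed)"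
    using A unfolding borel_eq_closed by simp
  then show ?thesis using e
  proof (induction arbitrary: e)
    case (Basic C)
    define V where "V k = (\<Union>a\<in>C. ball a (inverse (real (Suc k))))" for k
    have V_open: "open (V k)" for k unfolding V_def by auto
    have C_sub: "C \<subseteq> V k" for k unfolding V_def by force
    have dec: "decseq (\<lambda>k. V k - C)"
    proof (rule decseq_SucI)
      fix k
      have "inverse (real (Suc (Suc k))) \<le> inverse (real (Suc k))"
        by (rule le_imp_inverse_le) auto
      then have "ball a (inverse (real (Suc (Suc k)))) \<subseteq> ball a (inverse (real (Suc k)))" for a :: 'a
        by (rule subset_ball)
      then have "V (Suc k) \<subseteq> V k" unfolding V_def by blast
      then show "V (Suc k) - C \<subseteq> V k - C" by blast
    qed
    have "x \<in> C" if inV: "\<And>k. x \<in> V k" for x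
    proof -
      have "\<exists>y\<in>C. dist y x < d" if "d > 0" for d
      proof -
        obtain k where "inverse (real (Suc k)) < d"
          using reals_Archimedean[OF \<open>d > 0\<close>] by auto
        moreover obtain y where "y \<in> C" "dist y x < inverse (real (Suc k))"
          using inV[of k] by (auto simp: V_def simp del: of_nat_Suc)
        ultimately show ?thesis by (intro bexI[of _ y]) auto
      qed
      then have "x \<in> closure C" by (simp add: closure_approachable)
      with Basic show ?thesis by simp
    qed
    then have empty: "(\<Inter>k. V k - C) = {}" by auto
    have "(\<lambda>k. emeasure N (V k - C)) \<longlonglongrightarrow> emeasure N (\<Inter>k. V k - C)"
      using V_open Basic.hyps dec fin' by (intro Lim_emeasure_decseq) auto
    then have "(\<lambda>k. emeasure N (V k - C)) \<longlonglongrightarrow> 0" unfolding empty by simp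
    then have "\<forall>\<^sub>F k in sequentially. emeasure N (V k - C) < ennreal e"
      using Basic.prems by (intro order_tendstoD(2)) auto
    then obtain k where "emeasure N (V k - C) < ennreal e"
      by (auto simp: eventually_sequentially)
    then show ?case using Basic.hyps V_open C_sub by (intro exI[of _ C] exI[of _ "V k"]) auto
  next
    case Empty
    then show ?case by (intro exI[of _ "{}"]) auto
  next
    case (Compl A)
    obtain F U where FU: "closed F" "open U" "F \<subseteq> A" "A \<subseteq> U"
        "emeasure N (U - F) < ennreal e"
      using Compl.IH[OF Compl.prems] by auto
    have "- F - - U = U - F" by auto
    then show ?case using FU by (intro exI[of _ "- U"] exI[of _ "- F"]) auto
  next
    case (Union A)
    have "\<exists>F U. closed F \<and> open U \<and> F \<subseteq> A i \<and> A i \<subseteq> U \<and>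
        emeasure N (U - F) < ennreal (e/2 * (1/2) ^ Suc i)" for i
      using Union.prems by (intro Union.IH) auto
    then obtain F U where FU: "\<And>i. closed (F i)" "\<And>i. open (U i)" "\<And>i. F i \<subseteq> A i"
        "\<And>i. A i \<subseteq> U i" "\<And>i. emeasure N (U i - F i) < ennreal (e/2 * (1/2) ^ Suc i)"
      by metis
    define D where "D n = (\<Union>i. U i) - (\<Union>i<n. F i)" for n
    have D_sets: "D n \<in> sets N" for n
      unfolding D_def using FU by (intro sets.Diff op cl) auto
    have "(\<Inter>n. D n) \<subseteq> (\<Union>i. U i - F i)" unfolding D_def by blast
    moreover have "(\<Union>i. U i - F i) \<in> sets N"
      using FU by (intro sets.countable_UN) auto
    ultimately have "emeasure N (\<Inter>n. D n) \<le> emeasure N (\<Union>i. U i - F i)"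
      by (rule emeasure_mono)
    also have "\<dots> \<le> ennreal (e/2)"
      using Union.prems FU by (intro emeasure_UN_le_geometric) (auto intro: less_imp_le)
    also have "\<dots> < ennreal e" using Union.prems by (simp add: ennreal_less_iff)
    finally have lt: "emeasure N (\<Inter>n. D n) < ennreal e" .
    have "(\<lambda>n. emeasure N (D n)) \<longlonglongrightarrow> emeasure N (\<Inter>n. D n)"
      using D_sets fin' by (intro Lim_emeasure_decseq decseq_SucI) (auto simp: D_def)
    from order_tendstoD(2)[OF this lt] obtain n where "emeasure N (D n) < ennreal e"
      by (auto simp: eventually_sequentially)
    moreover have "closed (\<Union>i<n. F i)" "open (\<Union>i. U i)" using FU by auto
    ultimately show ?case using FU(3,4) unfolding D_def
      by (intro exI[of _ "\<Union>i<n. F i"] exI[of _ "\<Union>i. U i"]) blast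
  qed
qed

text \<open>
  Working inside balls serves two purposes: the measure cut down to a ball is finite, so the
  sandwich applies, and a Borel hull of a set of finite measure differs from it by a null set,
  which may fail for sets of infinite measure.
\<close>

lemma borel_regular_open_superset:
  fixes M :: "'a::metric_space measure"
  assumes borel_sub: "sets borel \<subseteq> sets M"
    and finite_balls: "\<And>x r. emeasure M (ball x r) < \<infinity>"
    and reg: "borel_regular M" and E: "E \<in> sets M" and e: "0 < (e::real)"
  shows "\<exists>U. open U \<and> E \<subseteq> U \<and> emeasure M (U - E) < ennreal e"
proof -
  define B where "B n = ball (undefined::'a) (real n)" for n
  have op [simp]: "S \<in> sets M" if "open S" for S
    using that borel_sub by (auto intro: borel_open)
  have B_open: "open (B n)" for n unfolding B_def by simp
  have B_cover: "\<exists>n. x \<in> B n" for x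
    unfolding B_def using reals_Archimedean2[of "dist undefined x"] by auto
  have "\<exists>U. open U \<and> E \<inter> B n \<subseteq> U \<and> emeasure M (U - E) \<le> ennreal (e/2 * (1/2) ^ Suc n)" for n
  proof -
    have EB: "E \<inter> B n \<in> sets M" using E B_open by auto
    then obtain H where H: "H \<in> sets borel" "E \<inter> B n \<subseteq> H" "emeasure M H = emeasure M (E \<inter> B n)"
      using reg unfolding borel_regular_def by blast
    have H_M: "H \<in> sets M" using H borel_sub by auto
    have "emeasure M (E \<inter> B n) \<le> emeasure M (B n)"
      using B_open by (intro emeasure_mono) auto
    then have "emeasure M (E \<inter> B n) \<noteq> \<infinity>"
      using finite_balls[of undefined "real n"] by (auto simp: B_def top_unique)
    then have null: "emeasure M (H - E \<inter> B n) = 0"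
      using H EB H_M by (subst emeasure_Diff) auto
    define N where "N = density M (indicator (B n))"
    have N: "emeasure N S = emeasure M (B n \<inter> S)" if "S \<in> sets M" for S
      unfolding N_def using B_open that by (intro emeasure_restricted) auto
    have "emeasure N UNIV < \<infinity>"
      using finite_balls[of undefined "real n"] by (subst N) (auto simp: B_def)
    moreover have "sets borel \<subseteq> sets N" using borel_sub by (simp add: N_def)
    ultimately obtain F U where FU: "closed F" "open U" "F \<subseteq> H" "H \<subseteq> U"
        "emeasure N (U - F) < ennreal (e/2 * (1/2) ^ Suc n)"
      using borel_closed_open_sandwich[of N H "e/2 * (1/2) ^ Suc n"] H e by auto
    have F_M: "F \<in> sets M" using FU borel_sub by (auto intro: borel_closed)
    have "emeasure M (U \<inter> B n - E) \<le> emeasure M (B n \<inter> (U - F) \<union> (H - E \<inter> B n))"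
      using FU B_open F_M H_M E by (intro emeasure_mono sets.Un sets.Int sets.Diff) auto
    also have "\<dots> \<le> emeasure M (B n \<inter> (U - F)) + emeasure M (H - E \<inter> B n)"
      using FU B_open F_M H_M E by (intro emeasure_subadditive sets.Int sets.Diff) auto
    also have "\<dots> = emeasure N (U - F)"
      using null FU F_M by (subst N) auto
    also have "\<dots> \<le> ennreal (e/2 * (1/2) ^ Suc n)" using FU(5) by (rule less_imp_le)
    finally show ?thesis
      using FU H B_open by (intro exI[of _ "U \<inter> B n"]) auto
  qed
  then obtain U where U: "\<And>n. open (U n)" "\<And>n. E \<inter> B n \<subseteq> U n"
      "\<And>n. emeasure M (U n - E) \<le> ennreal (e/2 * (1/2) ^ Suc n)"
    by metis
  have "emeasure M ((\<Union>n. U n) - E) = emeasure M (\<Union>n. U n - E)"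
    by (rule arg_cong[where f = "emeasure M"]) auto
  also have "\<dots> \<le> ennreal (e/2)"
    using U E e by (intro emeasure_UN_le_geometric) auto
  also have "\<dots> < ennreal e" using e by (simp add: ennreal_less_iff)
  finally have "emeasure M ((\<Union>n. U n) - E) < ennreal e" .
  moreover have "E \<subseteq> (\<Union>n. U n)" using B_cover U(2) by blast
  ultimately show ?thesis using U(1) by (intro exI[of _ "\<Union>n. U n"]) auto
qed

section \<open>The weak Lusin theorem\<close>

text \<open>
  Second countability of the target turns continuity into countably many conditions, each of
  which costs an exceptional set of small measure. The union of these exceptional sets need not
  be open, so outer regularity is used once more to enlarge it to an open set.
\<close>

lemma borel_regular_imp_weak_lusin:
  fixes M :: "'a::metric_space measure"
  assumes space_M: "space M = UNIV" and borel_sub: "sets borel \<subseteq> sets M"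
    and finite_balls: "\<And>x r. emeasure M (ball x r) < \<infinity>"
    and reg: "borel_regular M"
  shows "weak_lusin M"
  unfolding weak_lusin_def
proof (intro ballI allI impI)
  fix u :: "'a \<Rightarrow> ereal" and e :: real
  assume u: "u \<in> measurable M borel" and e: "0 < e"
  note outer = borel_regular_open_superset[OF borel_sub finite_balls reg]
  have op [simp]: "S \<in> sets M" if "open S" for S
    using that borel_sub by (auto intro: borel_open)
  obtain \<V> :: "ereal set set" where \<V>: "countable \<V>" "topological_basis \<V>"
    using ex_countable_basis by auto
  obtain V\<^sub>0 where "V\<^sub>0 \<in> \<V>"
    by (rule topological_basisE[OF \<V>(2) open_UNIV UNIV_I])
  then have V: "range (from_nat_into \<V>) = \<V>"
    using \<V>(1) by (intro range_from_nat_into) auto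
  define V where "V = from_nat_into \<V>"
  note V = V[folded V_def]
  have V_open: "open (V n)" for n
    using topological_basis_open[OF \<V>(2)] V by auto
  have pre: "u -` V n \<in> sets M" for n
    using measurable_sets[OF u, of "V n"] V_open space_M by auto
  have "\<exists>U. open U \<and> u -` V n \<subseteq> U \<and> emeasure M (U - u -` V n) < ennreal (e/2 * (1/2) ^ Suc n)" for n
    using e by (intro outer pre) auto
  then obtain U where U: "\<And>n. open (U n)" "\<And>n. u -` V n \<subseteq> U n"
      "\<And>n. emeasure M (U n - u -` V n) < ennreal (e/2 * (1/2) ^ Suc n)"
    by metis
  define G where "G = (\<Union>n. U n - u -` V n)"
  have G_M: "G \<in> sets M" 
  proof -
    have "U n - u -` V n \<in> sets M" for n using op[OF U(1)] pre by (rule sets.Diff)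
    then show ?thesis unfolding G_def by (intro sets.countable_UN) auto
  qed
  have G_le: "emeasure M G \<le> ennreal (e/2)"
    unfolding G_def using U pre e by (intro emeasure_UN_le_geometric) (auto intro: less_imp_le)
  obtain W where W: "open W" "G \<subseteq> W" "emeasure M (W - G) < ennreal (e/4)"
    using outer[OF G_M, of "e/4"] e by auto
  have "emeasure M W = emeasure M (G \<union> (W - G))"
    using W by (intro arg_cong[where f = "emeasure M"]) auto
  also have "\<dots> \<le> emeasure M G + emeasure M (W - G)"
    using G_M W by (intro emeasure_subadditive) auto
  also have "\<dots> \<le> ennreal (e/2) + ennreal (e/4)"
    using G_le less_imp_le[OF W(3)] by (rule add_mono)
  also have "\<dots> = ennreal (e/2 + e/4)" using e by (intro ennreal_plus[symmetric]) auto
  also have "\<dots> < ennreal e" using e by (intro ennreal_lessI) auto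
  finally have "emeasure M (- (- W)) < ennreal e" by simp
  moreover have "continuous_on (- W) u"
    unfolding continuous_on_topological
  proof (intro ballI allI impI)
    fix x S assume x: "x \<in> - W" and S: "open S" "u x \<in> S"
    obtain Z where Z: "Z \<in> \<V>" "u x \<in> Z" "Z \<subseteq> S"
      by (rule topological_basisE[OF \<V>(2) S])
    then obtain n where n: "u x \<in> V n" "V n \<subseteq> S" using V by auto
    have "x \<in> U n" using n U(2) by auto
    moreover have "u y \<in> S" if "y \<in> - W" "y \<in> U n" for y
      using that n(2) W(2) unfolding G_def by auto
    ultimately show "\<exists>A. open A \<and> x \<in> A \<and> (\<forall>y\<in>- W. y \<in> A \<longrightarrow> u y \<in> S)"
      using U(1) by blast
  qed
  ultimately show "\<exists>C. closed C \<and> emeasure M (- C) < ennreal e \<and> continuous_on C u"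
    using W(1) by (intro exI[of _ "- W"]) auto
qed

section \<open>From weak to strong: extending extended-real functions\<close>

text \<open>
  The extended tangent is monotone and onto the extended reals, hence continuous; being injective on a
  compact interval, it has a continuous inverse.
\<close>

lemma compact_interval_homeomorphic_ereal:
  obtains q :: "real \<Rightarrow> ereal" and p
  where "homeomorphism {- (pi/2)..pi/2} UNIV q p"
proof -
  define q :: "real \<Rightarrow> ereal" where
    "q y = (if y \<le> - (pi/2) then - \<infinity> else if pi/2 \<le> y then \<infinity> else ereal (tan y))" for y
  have q_arctan: "q (arctan r) = ereal r" for r
    unfolding q_def using arctan_lbound[of r] arctan_ubound[of r] tan_arctan[of r] by auto
  have q_end: "q (- (pi/2)) = - \<infinity>" "q (pi/2) = \<infinity>"
    using pi_gt_zero by (auto simp: q_def simp del: pi_gt_zero)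
  have surj: "\<exists>y\<in>{- (pi/2)..pi/2}. q y = z" for z
  proof (cases z)
    case (real r)
    then show ?thesis using q_arctan[of r] arctan_lbound[of r] arctan_ubound[of r]
      by (intro bexI[of _ "arctan r"]) auto
  next
    case PInf
    then show ?thesis using q_end by (intro bexI[of _ "pi/2"]) auto
  next
    case MInf
    then show ?thesis using q_end by (intro bexI[of _ "- (pi/2)"]) auto
  qed
  then have image: "q ` {- (pi/2)..pi/2} = UNIV" by (auto simp: image_iff) metis
  have "continuous_on UNIV q"
  proof (rule continuous_onI_mono)
    have "range q = UNIV" using image by auto
    then show "open (range q)" by simp
    show "q x \<le> q y" if "x \<le> y" for x y
      using that by (auto simp: q_def intro: tan_mono_le)
  qed
  then have cont: "continuous_on {- (pi/2)..pi/2} q" by (rule continuous_on_subset) simp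
  have "inj_on q {- (pi/2)..pi/2}"
  proof (rule inj_on_inverseI)
    fix y assume y: "y \<in> {- (pi/2)..pi/2}"
    show "(\<lambda>z. if z = \<infinity> then pi/2 else if z = - \<infinity> then - (pi/2) else arctan (real_of_ereal z)) (q y) = y"
      using y by (auto simp: q_def arctan_tan)
  qed
  then obtain p where "homeomorphism {- (pi/2)..pi/2} UNIV q p"
    using homeomorphism_compact[OF _ cont image] by auto
  then show thesis by (rule that)
qed

lemma Tietze_ereal:
  fixes u :: "'a::metric_space \<Rightarrow> ereal"
  assumes C: "closed C" and u: "continuous_on C u"
  obtains g where "continuous_on UNIV g" "\<And>x. x \<in> C \<Longrightarrow> g x = u x"
proof -
  obtain q :: "real \<Rightarrow> ereal" and p where hom: "homeomorphism {- (pi/2)..pi/2} UNIV q p"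
    by (rule compact_interval_homeomorphic_ereal)
  have p: "continuous_on UNIV p" "\<And>z. p z \<in> {- (pi/2)..pi/2}" "\<And>z. q (p z) = z"
    and q: "continuous_on {- (pi/2)..pi/2} q"
    using hom unfolding homeomorphism_def by auto
  have "normal_space (euclidean :: 'a topology)"
    by (intro metrizable_imp_normal_space metrizable_space_euclidean)
  moreover have "closedin euclidean C" using C by simp
  moreover have "continuous_map (subtopology euclidean C) euclideanreal (\<lambda>x. p (u x))"
    using continuous_on_compose2[OF p(1) u] by simp
  moreover have "(\<lambda>x. p (u x)) ` C \<subseteq> {- (pi/2)..pi/2}" using p(2) by blast
  ultimately have "\<exists>h. continuous_map euclidean euclideanreal h \<and> (\<forall>x\<in>C. h x = p (u x)) \<and>
      h ` topspace euclidean \<subseteq> {- (pi/2)..pi/2}"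
    by (rule Tietze_extension_closed_real_interval[where a = "- (pi/2)" and b = "pi/2"])
      (use pi_ge_zero in \<open>auto simp del: pi_ge_zero\<close>)
  then obtain h where h: "continuous_map euclidean euclideanreal h"
      "\<And>x. x \<in> C \<Longrightarrow> h x = p (u x)" "h ` topspace euclidean \<subseteq> {- (pi/2)..pi/2}"
    by auto
  show thesis
  proof
    show "continuous_on UNIV (\<lambda>x. q (h x))"
      using h(1,3) by (intro continuous_on_compose2[OF q]) auto
    show "q (h x) = u x" if "x \<in> C" for x
      using that h(2) p(3) by simp
  qed
qed

lemma weak_lusin_iff_strong_lusin: "weak_lusin M \<longleftrightarrow> strong_lusin M"
proof
  assume "weak_lusin M"
  then show "strong_lusin M"
    unfolding weak_lusin_def strong_lusin_def by (metis Tietze_ereal)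
next
  assume strong: "strong_lusin M"
  have "continuous_on C u" if "continuous_on UNIV g" "\<forall>x\<in>C. g x = u x"
    for C and u g :: "'a \<Rightarrow> ereal"
    using that continuous_on_subset[of UNIV g C] continuous_on_cong[of C C g u] by auto
  with strong show "weak_lusin M"
    unfolding weak_lusin_def strong_lusin_def by metis
qed

section \<open>Borel representatives and Borel hulls\<close>

lemma weak_lusin_imp_borel_representatives:
  fixes M :: "'a::metric_space measure"
  assumes borel_sub: "sets borel \<subseteq> sets M" and lusin: "weak_lusin M"
  shows "borel_representatives M"
  unfolding borel_representatives_def
proof
  fix u :: "'a \<Rightarrow> ereal" assume u: "u \<in> measurable M borel"
  have "\<exists>C. closed C \<and> emeasure M (- C) < ennreal (inverse (real (Suc n))) \<and> continuous_on C u" for n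
    using lusin u unfolding weak_lusin_def by auto
  then obtain C where C: "\<And>n. closed (C n)" "\<And>n. continuous_on (C n) u"
      "\<And>n. emeasure M (- C n) < ennreal (inverse (real (Suc n)))"
    by metis
  define N where "N = - (\<Union>n. C n)"
  \<comment> \<open>\<open>u\<close> itself need not be Borel on the null set \<open>N\<close>, so it is replaced there by a constant.\<close>
  define f where "f x = (if x \<in> N then 0 else u x)" for x
  have N_borel: "N \<in> sets borel"
    unfolding N_def using C(1) by (intro borel_comp sets.countable_UN) (auto intro: borel_closed)
  have "emeasure M N \<le> 0"
  proof (rule LIMSEQ_le_const)
    show "(\<lambda>n. ennreal (inverse (real (Suc n)))) \<longlonglongrightarrow> 0"
      using tendsto_ennrealI[OF LIMSEQ_inverse_real_of_nat] by simp
    have "emeasure M N \<le> ennreal (inverse (real (Suc n)))" for n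
    proof -
      have "emeasure M N \<le> emeasure M (- C n)"
        using C(1) borel_sub by (intro emeasure_mono) (auto simp: N_def intro!: subsetD[OF borel_sub] borel_open)
      with C(3)[of n] show ?thesis by auto
    qed
    then show "\<exists>m. \<forall>n\<ge>m. emeasure M N \<le> ennreal (inverse (real (Suc n)))" by blast
  qed
  moreover have "f \<in> measurable borel borel"
  proof (rule measurable_piecewise_restrict[where C = "insert N (range C)"])
    show "countable (insert N (range C))" by simp
    show "\<Omega> \<inter> space borel \<in> sets borel" if "\<Omega> \<in> insert N (range C)" for \<Omega>
      using that N_borel C(1) by auto
    show "space borel \<subseteq> \<Union> (insert N (range C))" by (auto simp: N_def)
    show "f \<in> measurable (restrict_space borel \<Omega>) borel" if "\<Omega> \<in> insert N (range C)" for \<Omega>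
    proof (rule borel_measurable_continuous_on_restrict)
      have "continuous_on N f"
        using continuous_on_cong[of N N f "\<lambda>_. 0"] by (auto simp: f_def)
      moreover have "continuous_on (C n) f" for n
      proof -
        have "f x = u x" if "x \<in> C n" for x using that by (auto simp: f_def N_def)
        then show ?thesis using C(2)[of n] by (simp cong: continuous_on_cong)
      qed
      ultimately show "continuous_on \<Omega> f" using that by auto
    qed
  qed
  ultimately show "\<exists>N\<in>sets borel. \<exists>f\<in>measurable borel borel.
      emeasure M N = 0 \<and> (\<forall>x\<in>- N. f x = u x)"
    using N_borel by (intro bexI[of _ N] bexI[of _ f]) (auto simp: f_def)
qed

lemma borel_representatives_imp_borel_regular:
  fixes M :: "'a::metric_space measure"
  assumes borel_sub: "sets borel \<subseteq> sets M" and rep: "borel_representatives M"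
  shows "borel_regular M"
  unfolding borel_regular_def
proof
  fix E assume E: "E \<in> sets M"
  then have "(indicator E :: 'a \<Rightarrow> ereal) \<in> measurable M borel" by simp
  then obtain N and f :: "'a \<Rightarrow> ereal" where N: "N \<in> sets borel" "emeasure M N = 0"
      and f: "f \<in> measurable borel borel" "\<And>x. x \<notin> N \<Longrightarrow> f x = indicator E x"
    using rep unfolding borel_representatives_def by (metis ComplI)
  \<comment> \<open>Off \<open>N\<close> the level set of \<open>f\<close> is exactly \<open>E\<close>, so the hull exceeds \<open>E\<close> only inside \<open>N\<close>.\<close>
  define B where "B = f -` {1} \<union> N"
  have "f -` {1} \<in> sets borel" using measurable_sets[OF f(1), of "{1}"] by simp
  then have B: "B \<in> sets borel" using N by (auto simp: B_def)
  have sub: "E \<subseteq> B" using f(2) by (auto simp: B_def)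
  have N_M: "N \<in> sets M" using N borel_sub by auto
  have "B \<subseteq> E \<union> N"
    unfolding B_def using f(2) by (auto simp: indicator_def split: if_splits)
  then have "emeasure M B \<le> emeasure M (E \<union> N)"
    using E N_M by (intro emeasure_mono) auto
  also have "\<dots> \<le> emeasure M E + emeasure M N"
    using E N_M by (rule emeasure_subadditive)
  finally have "emeasure M B \<le> emeasure M E" using N by simp
  moreover have "emeasure M E \<le> emeasure M B"
    using sub B borel_sub by (intro emeasure_mono) auto
  ultimately show "\<exists>B\<in>sets borel. E \<subseteq> B \<and> emeasure M B = emeasure M E"
    using B sub by (intro bexI[of _ B]) auto
qed

theorem theorem1p1:
  fixes M :: "'a::metric_space measure"
  assumes space_M: "space M = UNIV"
    and borel_sub: "sets borel \<subseteq> sets M"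
    and finite_balls: "\<And>x r. emeasure M (ball x r) < \<infinity>"
  shows "(borel_regular M \<longleftrightarrow> borel_representatives M)
       \<and> (borel_representatives M \<longleftrightarrow> weak_lusin M)
       \<and> (weak_lusin M \<longleftrightarrow> strong_lusin M)"
  using borel_regular_imp_weak_lusin[OF space_M borel_sub finite_balls]
    weak_lusin_imp_borel_representatives[OF borel_sub]
    borel_representatives_imp_borel_regular[OF borel_sub]
    weak_lusin_iff_strong_lusin[of M]
  by blast

end
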